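(* Let $G=(V,E,\mathcal{W})$ be a matrix-weighted network as described in the context. Then $G$ is coherent if and only if there is a partition $\{V_1,\dots,V_{l_p}\}$ of $V$ such that (i) every edge $(v_i,v_j)\in E$ with $v_i,v_j$ in the same part has transformation $\mathbf{R}_{ij}=\mathbf{I}$; (ii) for every ordered pair of parts $(V_a,V_b)$, all edges $(v_i,v_j)\in E$ with $v_i\in V_a$, $v_j\in V_b$ have the same transformation $\mathbf{R}_{ij}$; and (iii) considering each part as a super node, joined by a directed edge from $V_a$ to $V_b$ ($a\ne b$) carrying this common transformation whenever such edges exist, the transformation of every directed cycle of super nodes is $\mathbf{I}$.
   Context: A matrix-weighted network (MWN) is $G=(V,E,\mathcal{W})$ with node set $V=\{v_1,\dots,v_n\}$ and edge set $E\subset V\times V$, whose underlying graph is connected. For a fixed dimension $n_d$, each ordered pair $(i,j)$ carries a matrix $\mathbf{W}_{ij}\in\mathbb{R}^{n_d\times n_d}$, with $\mathbf{W}_{ij}=0$ if and only if $(v_i,v_j)\notin E$, and $\mathbf{W}_{ij}=\mathbf{W}_{ji}^T$ for all $i,j$. Write $w_{ij}=\|\mathbf{W}_{ij}\|_2$ and, for edges, $\mathbf{R}_{ij}=\mathbf{W}_{ij}/w_{ij}$, the transformation of the edge $(v_i,v_j)$; $\mathbf{I}$ denotes the $n_d\times n_d$ identity. The transformation of a directed path or directed cycle with consecutive edges $e_1,\dots,e_k$ is the product $\mathbf{R}(e_1)\mathbf{R}(e_2)\cdots\mathbf{R}(e_k)$; a directed cycle is a sequence of edges $(v_{i_1},v_{i_2}),(v_{i_2},v_{i_3}),\dots,(v_{i_l},v_{i_1})\in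 E$ ($l\ge 2$, $v_{i_1},\dots,v_{i_l}$ distinct), with transformation $\mathbf{R}_{i_1i_2}\mathbf{R}_{i_2i_3}\cdots\mathbf{R}_{i_li_1}$. The MWN $G$ is called coherent if the transformation of every directed cycle is $\mathbf{I}$ (in particular, taking 2-cycles, all $\mathbf{R}_{ij}$ are then orthogonal). *)

theory Defs
  imports "HOL-Analysis.Analysis" "HOL-Library.Disjoint_Sets"
begin

text \<open>Matrix-weighted network on a finite node type 'v (V = UNIV), with
  n_d x n_d real matrices (n_d = CARD('d)).  W i j is the weight matrix of
  the ordered pair (i,j); (i,j) is an edge iff W i j \<noteq> 0.\<close>

definition mwn :: "('v::finite \<Rightarrow> 'v \<Rightarrow> real^'d^'d) \<Rightarrow> bool" where
  "mwn W \<longleftrightarrow>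
     (\<forall>i j. W i j = transpose (W j i)) \<and>
     (\<forall>i. W i i = 0) \<and>
     (\<forall>i j. (i, j) \<in> {(a, b). W a b \<noteq> 0}\<^sup>*)"

definition is_edge :: "('v \<Rightarrow> 'v \<Rightarrow> real^'d^'d) \<Rightarrow> 'v \<Rightarrow> 'v \<Rightarrow> bool" where
  "is_edge W i j \<longleftrightarrow> W i j \<noteq> 0"

text \<open>Spectral norm w_ij = ||W_ij||_2 (operator norm) and transformation R_ij = W_ij / w_ij.\<close>
definition wnorm :: "real^'d^'d \<Rightarrow> real" where
  "wnorm A = onorm (\<lambda>x. A *v x)"

definition transf :: "('v \<Rightarrow> 'v \<Rightarrow> real^'d^'d) \<Rightarrow> 'v \<Rightarrow> 'v \<Rightarrow> real^'d^'d" where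
  "transf W i j = (1 / wnorm (W i j)) *\<^sub>R W i j"

text \<open>Directed cycle in a digraph given by adjacency adj on vertex set S:
  list of l \<ge> 2 distinct vertices, consecutive (cyclically) adjacent.\<close>
definition is_dcycle :: "'a set \<Rightarrow> ('a \<Rightarrow> 'a \<Rightarrow> bool) \<Rightarrow> 'a list \<Rightarrow> bool" where
  "is_dcycle S adj vs \<longleftrightarrow> 2 \<le> length vs \<and> distinct vs \<and> set vs \<subseteq> S \<and>
     (\<forall>k < length vs. adj (vs ! k) (vs ! ((k + 1) mod length vs)))"

text \<open>Transformation of the cycle: ordered product f(v1,v2) f(v2,v3) ... f(vl,v1).\<close>
definition cycle_transf :: "('a \<Rightarrow> 'a \<Rightarrow> real^'d^'d) \<Rightarrow> 'a list \<Rightarrow> real^'d^'d" where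
  "cycle_transf f vs =
     foldr (**) (map (\<lambda>k. f (vs ! k) (vs ! ((k + 1) mod length vs))) [0..<length vs]) (mat 1)"

definition coherent :: "('v::finite \<Rightarrow> 'v \<Rightarrow> real^'d^'d) \<Rightarrow> bool" where
  "coherent W \<longleftrightarrow>
     (\<forall>vs. is_dcycle UNIV (is_edge W) vs \<longrightarrow> cycle_transf (transf W) vs = mat 1)"

text \<open>Super-node digraph on the parts of a partition P.\<close>
definition super_edge :: "('v \<Rightarrow> 'v \<Rightarrow> real^'d^'d) \<Rightarrow> 'v set \<Rightarrow> 'v set \<Rightarrow> bool" where
  "super_edge W A B \<longleftrightarrow> A \<noteq> B \<and> (\<exists>i\<in>A. \<exists>j\<in>B. is_edge W i j)"

end

theory Submission
  imports Defs
begin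

(* Only if: the partition into singletons works, since its super-node cycles are exactly the
   cycles of G.  If: map every node to its part.  An edge inside a part has transformation I and
   an edge between parts has the transformation of the corresponding super edge, so a cycle of G
   becomes a closed walk of super nodes, possibly with stationary steps, with the same
   transformation.  A closed walk that is not a cycle splits at a repeated super node into two
   shorter closed walks, so by induction on the length every closed walk has transformation I. *)

fun walk_transf :: "('a \<Rightarrow> 'a \<Rightarrow> real^'d^'d) \<Rightarrow> 'a list \<Rightarrow> real^'d^'d" where
  "walk_transf f (x # y # r) = f x y ** walk_transf f (y # r)"
| "walk_transf f _ = mat 1"

lemma walk_transf_append:
  "walk_transf f (xs @ a # ys) = walk_transf f (xs @ [a]) ** walk_transf f (a # ys)"
  by (induction xs rule: induct_list012) (simp_all add: matrix_mul_lid matrix_mul_assoc)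

lemma walk_transf_cong:
  "successively E xs \<Longrightarrow> (\<And>x y. E x y \<Longrightarrow> f x y = g x y) \<Longrightarrow> walk_transf f xs = walk_transf g xs"
  by (induction xs rule: induct_list012) auto

lemma walk_transf_eq_foldr:
  "walk_transf f xs = foldr (**) (map (\<lambda>k. f (xs ! k) (xs ! Suc k)) [0..<length xs - 1]) (mat 1)"
proof (induction f xs rule: walk_transf.induct)
  case (1 f x y r)
  have "[0..<Suc (length r)] = 0 # map Suc [0..<length r]"
    by (simp add: map_Suc_upt upt_conv_Cons del: upt_Suc)
  then show ?case using 1 by (simp add: o_def)
qed auto

lemma nth_Suc_append_hd:
  assumes "k < length vs"
  shows "(vs @ [hd vs]) ! Suc k = vs ! (Suc k mod length vs)"
proof (cases "Suc k < length vs")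
  case False
  with assms have "Suc k = length vs" "vs \<noteq> []" by auto
  then show ?thesis by (simp add: nth_append hd_conv_nth)
qed (simp add: nth_append)

lemma cycle_transf_eq_walk_transf:
  "vs \<noteq> [] \<Longrightarrow> cycle_transf f vs = walk_transf f (vs @ [hd vs])"
  unfolding cycle_transf_def walk_transf_eq_foldr
proof (intro arg_cong[where f="\<lambda>l. foldr (**) l (mat 1)"] map_cong)
  fix k assume "k \<in> set [0..<length (vs @ [hd vs]) - 1]"
  then have "k < length vs" by simp
  then show "f (vs ! k) (vs ! ((k + 1) mod length vs)) =
      f ((vs @ [hd vs]) ! k) ((vs @ [hd vs]) ! Suc k)"
    by (simp only: nth_Suc_append_hd Suc_eq_plus1[symmetric]) (simp add: nth_append)
qed simp

lemma cycle_transf_map: "cycle_transf g (map h vs) = cycle_transf (\<lambda>x y. g (h x) (h y)) vs"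
  unfolding cycle_transf_def length_map
proof (intro arg_cong[where f="\<lambda>l. foldr (**) l (mat 1)"] map_cong)
  fix k assume "k \<in> set [0..<length vs]"
  then have "k < length vs" "(k + 1) mod length vs < length vs"
    by (auto intro: mod_less_divisor)
  then show "g (map h vs ! k) (map h vs ! ((k + 1) mod length vs)) =
      g (h (vs ! k)) (h (vs ! ((k + 1) mod length vs)))"
    by simp
qed simp

lemma distinct_imp_distinct_adj: "distinct xs \<Longrightarrow> distinct_adj xs"
  by (induction xs rule: induct_list012) auto

lemma distinct_adj_append_hd: "distinct vs \<Longrightarrow> 2 \<le> length vs \<Longrightarrow> distinct_adj (vs @ [hd vs])"
proof -
  assume "distinct vs" "2 \<le> length vs"
  then obtain x ys where "vs = x # ys" "ys \<noteq> []" "distinct (x # ys)"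
    by (cases vs) fastforce+
  then show ?thesis
    unfolding distinct_adj_append_iff by (auto simp: distinct_imp_distinct_adj)
qed

definition closed_walk :: "'a set \<Rightarrow> ('a \<Rightarrow> 'a \<Rightarrow> bool) \<Rightarrow> 'a list \<Rightarrow> bool" where
  "closed_walk S adj vs \<longleftrightarrow> vs \<noteq> [] \<and> set vs \<subseteq> S \<and> successively adj (vs @ [hd vs])"

lemma is_dcycle_iff_closed_walk:
  "is_dcycle S adj vs \<longleftrightarrow> 2 \<le> length vs \<and> distinct vs \<and> closed_walk S adj vs"
proof -
  have "successively adj (vs @ [hd vs]) \<longleftrightarrow>
      (\<forall>k < length vs. adj ((vs @ [hd vs]) ! k) ((vs @ [hd vs]) ! Suc k))"
    by (simp only: successively_conv_nth length_append_singleton Suc_less_eq)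
  also have "\<dots> \<longleftrightarrow> (\<forall>k < length vs. adj (vs ! k) (vs ! ((k + 1) mod length vs)))"
    by (simp add: nth_append_left nth_Suc_append_hd del: nth_append)
  finally show ?thesis
    unfolding is_dcycle_def closed_walk_def by auto
qed

lemma closed_walk_map:
  assumes "closed_walk S adj vs" "h ` S \<subseteq> S'"
    and "\<And>x y. x \<in> S \<Longrightarrow> y \<in> S \<Longrightarrow> adj x y \<Longrightarrow> adj' (h x) (h y)"
  shows "closed_walk S' adj' (map h vs)"
proof -
  have walk: "successively adj (vs @ [hd vs])" and "vs \<noteq> []" "set vs \<subseteq> S"
    using assms(1) unfolding closed_walk_def by auto
  then have "set (vs @ [hd vs]) \<subseteq> S" by auto
  from walk have "successively (\<lambda>x y. adj' (h x) (h y)) (vs @ [hd vs])"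
  proof (rule successively_mono)
    fix x y assume "x \<in> set (vs @ [hd vs])" "y \<in> set (vs @ [hd vs])" "adj x y"
    with \<open>set (vs @ [hd vs]) \<subseteq> S\<close> show "adj' (h x) (h y)"
      using assms(3) by blast
  qed
  then have "successively adj' (map h (vs @ [hd vs]))"
    unfolding successively_map .
  with \<open>vs \<noteq> []\<close> have "successively adj' (map h vs @ [hd (map h vs)])"
    by (simp add: hd_map)
  then show ?thesis
    using \<open>vs \<noteq> []\<close> \<open>set vs \<subseteq> S\<close> assms(2) unfolding closed_walk_def by auto
qed

lemma cycle_transf_cong:
  assumes "closed_walk S adj vs" "\<And>x y. adj x y \<Longrightarrow> f x y = g x y"
  shows "cycle_transf f vs = cycle_transf g vs"
  using assms walk_transf_cong[of adj "vs @ [hd vs]" f g]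
  unfolding closed_walk_def by (simp add: cycle_transf_eq_walk_transf)

lemma closed_walk_split:
  assumes "closed_walk S adj (p @ a # q @ a # r)"
  shows "closed_walk S adj (a # q)" "closed_walk S adj (p @ a # r)"
proof -
  have "hd (p @ a # q @ a # r) = hd (p @ a # r)"
    by (cases p) simp_all
  then show "closed_walk S adj (a # q)" "closed_walk S adj (p @ a # r)"
    using assms unfolding closed_walk_def
    by (auto simp: successively_append_iff successively_Cons hd_append)
qed

lemma is_dcycle_if_distinct_closed_walk:
  assumes "closed_walk S (\<lambda>x y. x = y \<or> adj x y) vs" "distinct vs" "2 \<le> length vs"
  shows "is_dcycle S adj vs"
proof -
  have "successively (\<noteq>) (vs @ [hd vs])"
    using distinct_adj_append_hd[OF assms(2,3)] unfolding distinct_adj_def .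
  moreover have "successively (\<lambda>x y. x = y \<or> adj x y) (vs @ [hd vs])"
    using assms(1) unfolding closed_walk_def by simp
  ultimately have "successively adj (vs @ [hd vs])"
    unfolding successively_conv_nth by blast
  then show ?thesis
    using assms unfolding is_dcycle_iff_closed_walk closed_walk_def by simp
qed

lemma cycle_transf_remove_loop:
  assumes "cycle_transf f (a # q) = mat 1"
  shows "cycle_transf f (p @ a # q @ a # r) = cycle_transf f (p @ a # r)"
proof -
  define h where "h = hd (p @ a # r)"
  have "hd (p @ a # q @ a # r) = h"
    unfolding h_def by (cases p) simp_all
  then have "cycle_transf f (p @ a # q @ a # r) = walk_transf f (p @ a # q @ a # r @ [h])"
    by (simp add: cycle_transf_eq_walk_transf)
  also have "\<dots> = walk_transf f (p @ [a]) ** walk_transf f (a # q @ [a])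
      ** walk_transf f (a # r @ [h])"
    using walk_transf_append[of f p a "q @ a # r @ [h]"]
      walk_transf_append[of f "a # q" a "r @ [h]"]
    by (simp add: matrix_mul_assoc)
  also have "walk_transf f (a # q @ [a]) = mat 1"
    using assms by (simp add: cycle_transf_eq_walk_transf)
  also have "walk_transf f (p @ [a]) ** mat 1 ** walk_transf f (a # r @ [h])
      = walk_transf f (p @ a # r @ [h])"
    by (simp add: walk_transf_append[of f p a "r @ [h]"] matrix_mul_rid)
  also have "\<dots> = cycle_transf f (p @ a # r)"
    unfolding h_def by (simp add: cycle_transf_eq_walk_transf)
  finally show ?thesis .
qed

lemma cycle_transf_closed_walk:
  assumes cycles: "\<And>cs. is_dcycle S adj cs \<Longrightarrow> cycle_transf f cs = mat 1"
    and loops: "\<And>x. f x x = mat 1"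
  shows "closed_walk S (\<lambda>x y. x = y \<or> adj x y) vs \<Longrightarrow> cycle_transf f vs = mat 1"
proof (induction "length vs" arbitrary: vs rule: less_induct)
  case less
  let ?adj = "\<lambda>x y. x = y \<or> adj x y"
  have walk: "closed_walk S ?adj vs" by fact
  then have "vs \<noteq> []" unfolding closed_walk_def by simp
  show ?case
  proof (cases "distinct vs")
    case True
    consider x where "vs = [x]" | "2 \<le> length vs"
      using \<open>vs \<noteq> []\<close> by (cases vs; cases "tl vs") auto
    then show ?thesis
    proof cases
      case 1
      then show ?thesis by (simp add: cycle_transf_def loops matrix_mul_rid)
    next
      case 2
      with walk True show ?thesis by (intro cycles is_dcycle_if_distinct_closed_walk)
    qed
  next
    case False
    then obtain p a q r where vs: "vs = p @ a # q @ a # r"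
      using not_distinct_decomp by fastforce
    have "closed_walk S ?adj (a # q)" "closed_walk S ?adj (p @ a # r)"
      using closed_walk_split[OF walk[unfolded vs]] by auto
    moreover have "length (a # q) < length vs" "length (p @ a # r) < length vs"
      by (simp_all add: vs)
    ultimately have "cycle_transf f (a # q) = mat 1" "cycle_transf f (p @ a # r) = mat 1"
      using less.hyps by blast+
    then show ?thesis
      unfolding vs by (simp add: cycle_transf_remove_loop)
  qed
qed

definition coherent_partition ::
    "('v \<Rightarrow> 'v \<Rightarrow> real^'d^'d) \<Rightarrow> 'v set set \<Rightarrow> ('v set \<Rightarrow> 'v set \<Rightarrow> real^'d^'d) \<Rightarrow> bool" where
  "coherent_partition W P T \<longleftrightarrow> partition_on UNIV P \<and>
     (\<forall>A\<in>P. \<forall>i\<in>A. \<forall>j\<in>A. is_edge W i j \<longrightarrow> transf W i j = mat 1) \<and>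
     (\<forall>A\<in>P. \<forall>B\<in>P. \<forall>i\<in>A. \<forall>j\<in>B. is_edge W i j \<longrightarrow> transf W i j = T A B) \<and>
     (\<forall>Vs. is_dcycle P (super_edge W) Vs \<longrightarrow> cycle_transf T Vs = mat 1)"

lemma coherent_partition_singletons:
  assumes "mwn W" "coherent W"
  shows "coherent_partition W (range (\<lambda>x. {x})) (\<lambda>A B. transf W (the_elem A) (the_elem B))"
proof -
  let ?P = "range (\<lambda>x. {x})"
  have no_loops: "\<not> is_edge W i i" for i
    using assms(1) unfolding mwn_def is_edge_def by blast
  have "cycle_transf (\<lambda>A B. transf W (the_elem A) (the_elem B)) Vs = mat 1"
    if cycle: "is_dcycle ?P (super_edge W) Vs" for Vs
  proof -
    have "inj_on the_elem ?P"
      by (auto simp: inj_on_def)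
    moreover have "set Vs \<subseteq> ?P"
      using cycle unfolding is_dcycle_def by simp
    ultimately have "inj_on the_elem (set Vs)"
      by (rule inj_on_subset)
    then have "distinct (map the_elem Vs)" "2 \<le> length (map the_elem Vs)"
      using cycle unfolding is_dcycle_def by (simp_all add: distinct_map)
    moreover have "closed_walk UNIV (is_edge W) (map the_elem Vs)"
    proof (rule closed_walk_map)
      show "closed_walk ?P (super_edge W) Vs"
        using cycle unfolding is_dcycle_iff_closed_walk by simp
    qed (auto simp: super_edge_def)
    ultimately have "cycle_transf (transf W) (map the_elem Vs) = mat 1"
      using assms(2) unfolding coherent_def is_dcycle_iff_closed_walk by blast
    then show ?thesis by (simp add: cycle_transf_map)
  qed
  then show ?thesis
    unfolding coherent_partition_def using no_loops by (auto simp: partition_on_singletons)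
qed

lemma coherent_partition_edge:
  assumes "coherent_partition W P T" and parts: "\<And>v. part_of v \<in> P" "\<And>v. v \<in> part_of v"
    and "is_edge W x y"
  shows "transf W x y = (if part_of x = part_of y then mat 1 else T (part_of x) (part_of y))"
    and "part_of x = part_of y \<or> super_edge W (part_of x) (part_of y)"
proof -
  have inner: "\<forall>A\<in>P. \<forall>i\<in>A. \<forall>j\<in>A. is_edge W i j \<longrightarrow> transf W i j = mat 1"
    and across: "\<forall>A\<in>P. \<forall>B\<in>P. \<forall>i\<in>A. \<forall>j\<in>B. is_edge W i j \<longrightarrow> transf W i j = T A B"
    using assms(1) unfolding coherent_partition_def by blast+
  show "transf W x y = (if part_of x = part_of y then mat 1 else T (part_of x) (part_of y))"
  proof (cases "part_of x = part_of y")
    case True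
    then have "x \<in> part_of y"
      using parts(2)[of x] by simp
    then have "transf W x y = mat 1"
      using inner parts(1,2) \<open>is_edge W x y\<close> by blast
    then show ?thesis using True by simp
  next
    case False
    then show ?thesis using across parts \<open>is_edge W x y\<close> by simp
  qed
  show "part_of x = part_of y \<or> super_edge W (part_of x) (part_of y)"
    using parts \<open>is_edge W x y\<close> unfolding super_edge_def by blast
qed

lemma coherent_if_coherent_partition:
  assumes "coherent_partition W P T"
  shows "coherent W"
proof -
  have "partition_on UNIV P"
    using assms unfolding coherent_partition_def by simp
  then have "\<forall>v. \<exists>A. A \<in> P \<and> v \<in> A"
    using partition_onD1 by blast
  then obtain part_of where parts: "\<And>v. part_of v \<in> P" "\<And>v. v \<in> part_of v"
    by metis
  define T' where "T' A B = (if A = B then mat 1 else T A B)" for A B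
  have super_T': "cycle_transf T' Vs = mat 1" if "is_dcycle P (super_edge W) Vs" for Vs
  proof -
    have "cycle_transf T' Vs = cycle_transf T Vs"
      using that unfolding is_dcycle_iff_closed_walk
      by (intro cycle_transf_cong[where adj="super_edge W"]) (auto simp: T'_def super_edge_def)
    with assms that show ?thesis unfolding coherent_partition_def by simp
  qed
  show ?thesis unfolding coherent_def
  proof (intro allI impI)
    fix vs assume "is_dcycle UNIV (is_edge W) vs"
    then have walk: "closed_walk UNIV (is_edge W) vs"
      by (simp add: is_dcycle_iff_closed_walk)
    have "cycle_transf (transf W) vs = cycle_transf (\<lambda>x y. T' (part_of x) (part_of y)) vs"
      using walk by (rule cycle_transf_cong)
        (simp add: T'_def coherent_partition_edge(1)[OF assms parts])
    also have "\<dots> = cycle_transf T' (map part_of vs)"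
      by (simp add: cycle_transf_map)
    also have "\<dots> = mat 1"
    proof (rule cycle_transf_closed_walk[where S=P and adj="super_edge W"])
      show "\<And>cs. is_dcycle P (super_edge W) cs \<Longrightarrow> cycle_transf T' cs = mat 1"
        by (rule super_T')
      show "T' A A = mat 1" for A
        by (simp add: T'_def)
      show "closed_walk P (\<lambda>A B. A = B \<or> super_edge W A B) (map part_of vs)"
        using walk by (rule closed_walk_map) (use parts coherent_partition_edge(2)[OF assms parts] in auto)
    qed
    finally show "cycle_transf (transf W) vs = mat 1" .
  qed
qed

theorem theorem1:
  fixes W :: "'v::finite \<Rightarrow> 'v \<Rightarrow> real^'d^'d"
  assumes "mwn W"
  shows "coherent W \<longleftrightarrow>
    (\<exists>P T. partition_on UNIV P \<and>
       (\<forall>A\<in>P. \<forall>i\<in>A. \<forall>j\<in>A. is_edge W i j \<longrightarrow> transf W i j = mat 1) \<and>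
       (\<forall>A\<in>P. \<forall>B\<in>P. \<forall>i\<in>A. \<forall>j\<in>B. is_edge W i j \<longrightarrow> transf W i j = T A B) \<and>
       (\<forall>Vs. is_dcycle P (super_edge W) Vs \<longrightarrow> cycle_transf T Vs = mat 1))"
proof -
  have "coherent W \<longleftrightarrow> (\<exists>P T. coherent_partition W P T)"
    using coherent_partition_singletons[OF assms] coherent_if_coherent_partition by blast
  then show ?thesis
    unfolding coherent_partition_def .
qed

end
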